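(* Let $k=\mathbb F_q$ be a finite field with $q$ elements, $n\ge 0$ an integer, and $a,b\in\mathbb Z$. Let $A^{I_n}_{a,b}=|Gr_{(a,b)}(I_n)|$ be the number of submodules of dimension vector $(a,b)$ of the indecomposable preinjective Kronecker module $I_n$ of dimension vector $(n,n+1)$ over $k$. Then $$A^{I_n}_{a,b}=\begin{cases}0 & \text{if } a>n \text{ or } b>n+1,\\ 1 & \text{if } a=n \text{ and } b=n+1,\\ G^{a-b}_{n-b}(q)\,G^{b}_{a+1}(q) & \text{otherwise.}\end{cases}$$
   Context: A Kronecker module over $k$ is a representation $V=(V_1,V_2;\alpha,\beta)$ consisting of finite dimensional $k$-vector spaces $V_1,V_2$ and two linear maps $\alpha,\beta:V_2\to V_1$; its dimension vector is $(\dim V_1,\dim V_2)$. A submodule is a pair of subspaces $U_i\subseteq V_i$ with $\alpha(U_2)+\beta(U_2)\subseteq U_1$; its dimension vector is $(\dim U_1,\dim U_2)$. There are no submodules of dimension vector $(a,b)$ if $a<0$ or $b<0$. $I_n$ is, up to isomorphism, the unique indecomposable Kronecker module of dimension vector $(n,n+1)$; explicitly $V_2=k^{n+1}$, $V_1=k^{n}$, $\alpha(x_1,\dots,x_{n+1})=(x_1,\dots,x_n)$, $\beta(x_1,\dots,x_{n+1})=(x_2,\dots,x_{n+1})$. Gaussian coefficients: for $a,l\in\mathbb Z$ with $l>0$, $G^l_a(q)=\frac{(q^a-1)(q^{a-1}-1)\cdots(q^{a-l+1}-1)}{(q^l-1)\cdots(q-1)}$; $G^0_a(q)=1$; $G^{l}_a(q)=0$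 for $l<0$. The lower index $a$ may be negative. *)

theory Defs
  imports Complex_Main "HOL-Library.Cardinality" "HOL-Library.FuncSet" "HOL-Library.Function_Algebras" "HOL-Library.Set_Algebras"
begin

text \<open>
  Kronecker modules. The two vector spaces are subspaces \<open>V\<^sub>1\<close>, \<open>V\<^sub>2\<close> of ambient vector spaces, so
  that families of spaces of varying dimension live in one type; only the restrictions of
  \<open>\<alpha>\<close> and \<open>\<beta>\<close> to \<open>V\<^sub>2\<close> matter.
\<close>

locale kronecker_module =
  W1: vector_space s1 + W2: vector_space s2
  for s1 :: "'k::field \<Rightarrow> 'v::ab_group_add \<Rightarrow> 'v"
    and s2 :: "'k \<Rightarrow> 'w::ab_group_add \<Rightarrow> 'w" +
  fixes V\<^sub>1 :: "'v set" and V\<^sub>2 :: "'w set" and \<alpha> \<beta> :: "'w \<Rightarrow> 'v"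
  assumes V1_findim: "\<exists>B. finite B \<and> W1.span B = V\<^sub>1"
    and V2_findim: "\<exists>B. finite B \<and> W2.span B = V\<^sub>2"
    and maps: "\<alpha> \<in> V\<^sub>2 \<rightarrow> V\<^sub>1" "\<beta> \<in> V\<^sub>2 \<rightarrow> V\<^sub>1"
    and add: "\<And>x y. x \<in> V\<^sub>2 \<Longrightarrow> y \<in> V\<^sub>2 \<Longrightarrow> \<alpha> (x + y) = \<alpha> x + \<alpha> y"
      "\<And>x y. x \<in> V\<^sub>2 \<Longrightarrow> y \<in> V\<^sub>2 \<Longrightarrow> \<beta> (x + y) = \<beta> x + \<beta> y"
    and scale: "\<And>c x. x \<in> V\<^sub>2 \<Longrightarrow> \<alpha> (s2 c x) = s1 c (\<alpha> x)"
      "\<And>c x. x \<in> V\<^sub>2 \<Longrightarrow> \<beta> (s2 c x) = s1 c (\<beta> x)"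
begin

definition submodule :: "'v set \<Rightarrow> 'w set \<Rightarrow> bool" where
  "submodule U\<^sub>1 U\<^sub>2 \<longleftrightarrow>
     W1.subspace U\<^sub>1 \<and> U\<^sub>1 \<subseteq> V\<^sub>1 \<and> W2.subspace U\<^sub>2 \<and> U\<^sub>2 \<subseteq> V\<^sub>2 \<and> \<alpha> ` U\<^sub>2 + \<beta> ` U\<^sub>2 \<subseteq> U\<^sub>1"

definition Gr :: "int \<Rightarrow> int \<Rightarrow> ('v set \<times> 'w set) set" where
  "Gr a b = {(U\<^sub>1, U\<^sub>2). submodule U\<^sub>1 U\<^sub>2 \<and> int (W1.dim U\<^sub>1) = a \<and> int (W2.dim U\<^sub>2) = b}"

end

text \<open>
  \<open>k\<^sup>n\<close> is the space of functions \<open>nat \<Rightarrow> k\<close> supported on \<open>{0..<n}\<close>; coordinates are numbered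
  from 0.
\<close>

definition vscale :: "'k::field \<Rightarrow> (nat \<Rightarrow> 'k) \<Rightarrow> nat \<Rightarrow> 'k" where
  "vscale c x = (\<lambda>i. c * x i)"

definition kvec :: "nat \<Rightarrow> (nat \<Rightarrow> 'k::field) set" where
  "kvec n = {x. \<forall>i\<ge>n. x i = 0}"

definition I_alpha :: "nat \<Rightarrow> (nat \<Rightarrow> 'k::field) \<Rightarrow> nat \<Rightarrow> 'k" where
  "I_alpha n x = (\<lambda>i. if i < n then x i else 0)"

definition I_beta :: "nat \<Rightarrow> (nat \<Rightarrow> 'k::field) \<Rightarrow> nat \<Rightarrow> 'k" where
  "I_beta n x = (\<lambda>i. if i < n then x (i + 1) else 0)"

global_interpretation kv: vector_space vscale
  by unfold_locales (auto simp: vscale_def fun_eq_iff algebra_simps)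

definition unit_fun :: "nat \<Rightarrow> nat \<Rightarrow> 'k::field" where
  "unit_fun j = (\<lambda>i. if i = j then 1 else 0)"

lemma sum_fun_apply: "(\<Sum>j\<in>A. f j) (i::nat) = (\<Sum>j\<in>A. f j i :: 'k::field)"
  by (induction A rule: infinite_finite_induct) auto

lemma sum_unit_fun:
  "(\<Sum>j<n. vscale (c j) (unit_fun j)) = (\<lambda>i. if i < n then c i else (0::'k::field))"
  by (auto simp: fun_eq_iff sum_fun_apply vscale_def unit_fun_def if_distrib cong: if_cong)

lemma inj_unit_fun: "inj (unit_fun :: nat \<Rightarrow> nat \<Rightarrow> 'k::field)"
  by (rule injI) (metis unit_fun_def zero_neq_one)

lemma subspace_kvec: "kv.subspace (kvec n)"
  by (auto simp: kv.subspace_def kvec_def vscale_def)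

lemma span_unit_fun: "kv.span (unit_fun ` {..<n}) = (kvec n :: (nat \<Rightarrow> 'k::field) set)"
proof
  show "kv.span (unit_fun ` {..<n}) \<subseteq> (kvec n :: (nat \<Rightarrow> 'k) set)"
    by (rule kv.span_minimal) (auto simp: subspace_kvec, auto simp: kvec_def unit_fun_def)
  show "(kvec n :: (nat \<Rightarrow> 'k) set) \<subseteq> kv.span (unit_fun ` {..<n})"
  proof
    fix x :: "nat \<Rightarrow> 'k" assume "x \<in> kvec n"
    then have "x = (\<Sum>j<n. vscale (x j) (unit_fun j))"
      by (auto simp: sum_unit_fun kvec_def fun_eq_iff)
    also have "\<dots> \<in> kv.span (unit_fun ` {..<n})"
      by (intro kv.span_sum kv.span_scale kv.span_base) auto
    finally show "x \<in> kv.span (unit_fun ` {..<n})" .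
  qed
qed

lemma independent_unit_fun: "kv.independent (unit_fun ` {..<n} :: (nat \<Rightarrow> 'k::field) set)"
proof (rule kv.independent_if_scalars_zero)
  fix f :: "(nat \<Rightarrow> 'k) \<Rightarrow> 'k" and x :: "nat \<Rightarrow> 'k"
  assume s: "(\<Sum>x\<in>unit_fun ` {..<n}. vscale (f x) x) = 0" and x: "x \<in> unit_fun ` {..<n}"
  have "(\<Sum>j<n. vscale (f (unit_fun j)) (unit_fun j)) = 0"
    using s by (subst (asm) sum.reindex) (auto intro: inj_on_subset[OF inj_unit_fun])
  then have *: "(\<lambda>i. if i < n then f (unit_fun i) else 0) = 0"
    by (simp only: sum_unit_fun)
  obtain i where "i < n" "x = unit_fun i"
    using x by blast
  then show "f x = 0"
    using fun_cong[OF *, of i] by simp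
qed auto

lemma dim_kvec: "kv.dim (kvec n :: (nat \<Rightarrow> 'k::field) set) = n"
proof -
  have "kv.dim (kvec n :: (nat \<Rightarrow> 'k) set) = card (unit_fun ` {..<n} :: (nat \<Rightarrow> 'k) set)"
    by (metis kv.dim_eq_card span_unit_fun independent_unit_fun kv.span_span)
  also have "\<dots> = n"
    by (subst card_image) (auto intro: inj_on_subset[OF inj_unit_fun])
  finally show ?thesis .
qed

global_interpretation preinj:
  kronecker_module vscale vscale "kvec n" "kvec (n + 1)" "I_alpha n" "I_beta n" for n
proof (unfold_locales, goal_cases)
  case 1 show ?case by (rule exI[of _ "unit_fun ` {..<n}"]) (simp add: span_unit_fun)
next
  case 2 show ?case by (rule exI[of _ "unit_fun ` {..<n + 1}"]) (simp only: span_unit_fun finite_imageI finite_lessThan simp_thms)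
qed (auto simp: kvec_def I_alpha_def I_beta_def vscale_def fun_eq_iff)

text \<open>\<open>gauss l a q\<close> is \<open>G\<^sup>l\<^sub>a(q)\<close>: the upper index comes first.\<close>

definition gauss :: "int \<Rightarrow> int \<Rightarrow> real \<Rightarrow> real" where
  "gauss l a q =
     (if l < 0 then 0
      else (\<Prod>i=0..<nat l. q powi (a - int i) - 1) / (\<Prod>i=1..nat l. q ^ i - 1))"

end

theory Submission
  imports Defs "HOL-Library.Disjoint_Sets"
begin

text \<open>
  Write \<open>e\<^sub>m\<close> for \<^term>\<open>unit_fun m\<close>. Deleting the last coordinates maps \<open>I\<^bsub>n+1\<^esub>\<close> onto \<open>I\<^sub>n\<close>; the kernel
  is spanned by \<open>e\<^sub>n\<close> and \<open>e\<^bsub>n+1\<^esub>\<close>. Let \<open>A\<^sub>n(a,b)\<close> count the submodules \<open>(U\<^sub>1,U\<^sub>2)\<close> of \<open>I\<^sub>n\<close> and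
  \<open>B\<^sub>n(a,b)\<close> those with \<open>e\<^sub>n \<notin> U\<^sub>2\<close>, that is, those on which \<open>\<alpha>\<close> is injective. Sorting the submodules
  of \<open>I\<^bsub>n+1\<^esub>\<close> by their intersection with the kernel and their image \<open>(W\<^sub>1,W\<^sub>2)\<close> in \<open>I\<^sub>n\<close> gives
  \<open>A\<^bsub>n+1\<^esub>(a,b) = A\<^sub>n(a-1,b-1) + B\<^bsub>n+1\<^esub>(a,b)\<close> and
  \<open>B\<^bsub>n+1\<^esub>(a,b) = q\<^sup>b A\<^sub>n(a-1,b) + q\<^bsup>a-b\<^esup> B\<^sub>n(a,b)\<close>: if \<open>e\<^sub>n \<in> U\<^sub>1\<close>, then \<open>U\<^sub>2\<close> is an arbitrary complement
  of \<open>e\<^bsub>n+1\<^esub>\<close> in the preimage of \<open>W\<^sub>2\<close>; otherwise \<open>U\<^sub>1\<close> is a complement of \<open>e\<^sub>n\<close> in the preimage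
  of \<open>W\<^sub>1\<close> that contains \<open>\<alpha>(U\<^sub>2) = W\<^sub>2\<close>, and \<open>U\<^sub>1\<close> determines \<open>U\<^sub>2\<close>. The same recursion holds for
  the closed forms by Pascal's rule for Gaussian coefficients.
\<close>

section \<open>Complements of a line\<close>

text \<open>For finite \<open>P \<ni> e\<close> these are the complements in \<open>P\<close> of the line through \<open>e\<close> that contain \<open>U\<^sub>0\<close>.\<close>

definition (in vector_space) hyperplanes_avoiding :: "'b \<Rightarrow> 'b set \<Rightarrow> 'b set \<Rightarrow> 'b set set" where
  "hyperplanes_avoiding e P U\<^sub>0 =
     {U. subspace U \<and> U\<^sub>0 \<subseteq> U \<and> U \<subseteq> P \<and> e \<notin> U \<and> card P = CARD('a) * card U}"

context vector_space
begin

text \<open>Each element of the span is \<open>u + scale c e\<close> for exactly one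
  \<open>c\<close> and one \<open>u\<close> in \<open>U\<close>. Infinite sets are covered too: both
  sides are then 0.\<close>

lemma card_span_insert:
  assumes "e \<notin> U" "subspace U"
  shows "card (span (insert e U)) = CARD('a) * card U"
proof -
  have sp: "span U = U"
    using assms by (simp add: span_eq_iff)
  have "bij_betw (\<lambda>(c, u). u + scale c e) (UNIV \<times> U) (span (insert e U))"
    unfolding bij_betw_def
  proof
    show "inj_on (\<lambda>(c, u). u + scale c e) (UNIV \<times> U)"
    proof (rule inj_onI, clarsimp)
      fix c u d v assume u: "u \<in> U" "v \<in> U" and eq: "u + scale c e = v + scale d e"
      have "scale (c - d) e = v - u"
        using eq by (simp add: scale_left_diff_distrib algebra_simps)
      then have *: "scale (c - d) e \<in> U"
        using u assms subspace_diff by metis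
      have "c = d"
      proof (rule ccontr)
        assume "c \<noteq> d"
        then have "e = scale (inverse (c - d)) (scale (c - d) e)" by simp
        then show False using * assms subspace_scale by metis
      qed
      then show "c = d \<and> u = v" using eq by simp
    qed
    show "(\<lambda>(c, u). u + scale c e) ` (UNIV \<times> U) = span (insert e U)"
    proof (intro set_eqI iffI)
      fix x assume "x \<in> span (insert e U)"
      then obtain k where "x - scale k e \<in> U"
        by (auto simp: span_breakdown_eq sp)
      then show "x \<in> (\<lambda>(c, u). u + scale c e) ` (UNIV \<times> U)"
        by (intro image_eqI[of _ _ "(k, x - scale k e)"]) auto
    next
      fix x assume "x \<in> (\<lambda>(c, u). u + scale c e) ` (UNIV \<times> U)"
      then obtain c u where "u \<in> U" "x = u + scale c e" by auto
      then have "u \<in> U" "x - scale c e = u" by auto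
      then show "x \<in> span (insert e U)"
        by (auto simp: span_breakdown_eq sp)
    qed
  qed
  from bij_betw_same_card[OF this] show ?thesis
    by (simp add: card_cartesian_product)
qed

lemma card_span_independent:
  assumes "finite B" "independent B"
  shows "card (span B) = CARD('a) ^ card B"
  using assms
proof (induction B rule: finite_induct)
  case (insert x B)
  then have "x \<notin> span B" "independent B"
    by (auto simp: independent_insert)
  then show ?case
    using insert card_span_insert[of x "span B"] by (simp add: span_insert span_span)
qed auto

lemma card_subspace_eq:
  assumes "subspace U" "finite U"
  shows "card U = CARD('a) ^ dim U"
proof -
  obtain B where B: "B \<subseteq> U" "independent B" "U \<subseteq> span B" "card B = dim U"
    using basis_exists[of U] by blast
  then have "span B = U" using assms span_minimal by blast
  then show ?thesis
    using B assms finite_subset card_span_independent[of B] by metis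
qed

lemma dim_eq_if_card_eq:
  assumes "finite (UNIV :: 'a set)" "subspace U" "finite U" "card U = CARD('a) ^ d"
  shows "dim U = d"
proof -
  have "CARD('a) > 1"
    using assms(1) card_mono[of UNIV "{0, 1 :: 'a}"] by simp
  then show ?thesis
    using assms card_subspace_eq[of U] power_inject_exp[of "CARD('a)"] by metis
qed

text \<open>The span lies in \<open>P\<close> and has \<open>CARD('a) * card U\<close> elements,
  which is the size that \<open>hyperplanes_avoiding\<close> prescribes for
  \<open>P\<close>.\<close>

lemma span_insert_eq_if_hyperplane:
  assumes "U \<in> hyperplanes_avoiding e P U\<^sub>0" "e \<in> P" "subspace P" "finite P"
  shows "span (insert e U) = P"
proof (rule card_subset_eq)
  show "span (insert e U) \<subseteq> P"
    using assms by (intro span_minimal) (auto simp: hyperplanes_avoiding_def)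
qed (use assms in \<open>auto simp: hyperplanes_avoiding_def card_span_insert\<close>)

text \<open>A complement of the line through \<open>e\<close> meets every coset of that line in
  \<open>P\<close>, so it contains \<open>w - scale c e\<close> for some \<open>c\<close>. This is
  the case split for counting complements by induction.\<close>

lemma hyperplanes_avoiding_UN:
  assumes "e \<in> P" "subspace P" "finite P" "w \<in> P"
  shows "hyperplanes_avoiding e P U\<^sub>0 =
    (\<Union>c. hyperplanes_avoiding e P (span (insert (w - scale c e) U\<^sub>0)))" (is "?L = ?R")
proof
  show "?L \<subseteq> ?R"
  proof
    fix U assume U: "U \<in> ?L"
    then have "w \<in> span (insert e U)"
      using assms span_insert_eq_if_hyperplane by blast
    then obtain c where "w - scale c e \<in> U"
      using U by (auto simp: span_breakdown_eq hyperplanes_avoiding_def span_eq_iff[THEN iffD2])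
    then have "span (insert (w - scale c e) U\<^sub>0) \<subseteq> U"
      using U by (intro span_minimal) (auto simp: hyperplanes_avoiding_def)
    then have "U \<in> hyperplanes_avoiding e P (span (insert (w - scale c e) U\<^sub>0))"
      using U by (simp add: hyperplanes_avoiding_def)
    then show "U \<in> ?R" by blast
  qed
  show "?R \<subseteq> ?L"
  proof
    fix U assume "U \<in> ?R"
    then obtain c where c: "U \<in> hyperplanes_avoiding e P (span (insert (w - scale c e) U\<^sub>0))"
      by blast
    have "U\<^sub>0 \<subseteq> span (insert (w - scale c e) U\<^sub>0)"
      using span_superset[of "insert (w - scale c e) U\<^sub>0"] by simp
    then show "U \<in> ?L"
      using c unfolding hyperplanes_avoiding_def by blast
  qed
qed

lemma finite_hyperplanes_avoiding:
  assumes "finite P"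
  shows "finite (hyperplanes_avoiding e P U\<^sub>0)"
proof (rule finite_subset)
  show "hyperplanes_avoiding e P U\<^sub>0 \<subseteq> Pow P"
    by (auto simp: hyperplanes_avoiding_def)
qed (use assms in simp)

text \<open>Induction on \<open>d\<close>, the codimension in \<open>P\<close> of the sum of
  \<open>U\<^sub>0\<close> and the line through \<open>e\<close>. For \<open>w\<close> outside that
  sum, each complement contains exactly one of the \<open>CARD('a)\<close> vectors
  \<open>w - scale c e\<close>, and adjoining that vector to \<open>U\<^sub>0\<close> lowers
  \<open>d\<close> by one.\<close>

lemma card_hyperplanes_avoiding:
  assumes fin: "finite (UNIV :: 'a set)" "finite P"
    and P: "subspace P" "e \<in> P"
    and "subspace U\<^sub>0" "U\<^sub>0 \<subseteq> P" "e \<notin> U\<^sub>0" "card P = CARD('a) ^ Suc d * card U\<^sub>0"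
  shows "card (hyperplanes_avoiding e P U\<^sub>0) = CARD('a) ^ d"
  using assms(5-)
proof (induction d arbitrary: U\<^sub>0)
  case 0
  have "U = U\<^sub>0" if "U \<in> hyperplanes_avoiding e P U\<^sub>0" for U
    using that 0 fin finite_subset[of U P] card_subset_eq[of U U\<^sub>0]
    unfolding hyperplanes_avoiding_def by fastforce
  moreover have "U\<^sub>0 \<in> hyperplanes_avoiding e P U\<^sub>0"
    using 0 by (auto simp: hyperplanes_avoiding_def)
  ultimately have "hyperplanes_avoiding e P U\<^sub>0 = {U\<^sub>0}" by blast
  then show ?case by simp
next
  case (Suc d)
  have q: "CARD('a) > 1"
    using fin(1) card_mono[of UNIV "{0, 1 :: 'a}"] by simp
  have fU: "finite U\<^sub>0" using Suc.prems fin finite_subset by blast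
  have pos: "card U\<^sub>0 > 0" using fU Suc.prems subspace_0 card_gt_0_iff by blast
  \<comment> \<open>The right-hand side equals \<open>card P\<close>, so the sum of
    \<open>U\<^sub>0\<close> and the line is proper in \<open>P\<close>; this provides
    \<open>w\<close>.\<close>
  have "card (span (insert e U\<^sub>0)) < CARD('a) ^ Suc d * card (span (insert e U\<^sub>0))"
    using one_less_power[OF q, of "Suc d"] Suc.prems q pos by (simp add: card_span_insert ac_simps)
  then have "card (span (insert e U\<^sub>0)) < card P"
    using Suc.prems by (simp add: card_span_insert ac_simps)
  moreover have "span (insert e U\<^sub>0) \<subseteq> P"
    using Suc.prems P by (intro span_minimal) auto
  ultimately have "\<not> P \<subseteq> span (insert e U\<^sub>0)" by auto
  then obtain w where w: "w \<in> P" "w \<notin> span (insert e U\<^sub>0)" by blast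
  define V where "V c = span (insert (w - scale c e) U\<^sub>0)" for c
  have wce: "w - scale c e \<notin> span (insert e U\<^sub>0)" for c
    using w(2) span_add[of "w - scale c e" _ "scale c e"] span_scale[OF span_base[of e "insert e U\<^sub>0"]]
    by fastforce
  have wce': "w - scale c e \<notin> U\<^sub>0" for c
    using wce[of c] span_superset by blast
  have eV: "e \<notin> V c" for c
  proof
    assume "e \<in> V c"
    then have "e \<in> span (insert (w - scale c e) U\<^sub>0)" by (simp add: V_def)
    \<comment> \<open>Steinitz exchange, using that \<open>e\<close> is not in
      \<open>U\<^sub>0\<close>.\<close>
    then have "w - scale c e \<in> span (insert e U\<^sub>0)"
      using in_span_insert[of e "w - scale c e" U\<^sub>0] Suc.prems by (simp add: span_eq_iff[THEN iffD2])
    then show False using wce by blast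
  qed
  have VP: "V c \<subseteq> P" for c
    unfolding V_def using Suc.prems w P by (intro span_minimal) (auto intro!: subspace_diff subspace_scale)
  have "card (hyperplanes_avoiding e P (V c)) = CARD('a) ^ d" for c
    using Suc.prems eV VP wce'[of c] by (intro Suc.IH) (auto simp: V_def card_span_insert)
  moreover have "disjoint_family_on (\<lambda>c. hyperplanes_avoiding e P (V c)) UNIV"
  proof (clarsimp simp: disjoint_family_on_def)
    fix c c' :: 'a assume "c \<noteq> c'"
    show "hyperplanes_avoiding e P (V c) \<inter> hyperplanes_avoiding e P (V c') = {}"
    proof (rule equals0I)
      fix U assume U: "U \<in> hyperplanes_avoiding e P (V c) \<inter> hyperplanes_avoiding e P (V c')"
      then have sU: "subspace U" "V c \<subseteq> U" "V c' \<subseteq> U" "e \<notin> U"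
        by (auto simp: hyperplanes_avoiding_def)
      have "w - scale a e \<in> V a" for a by (auto simp: V_def intro: span_base)
      then have "w - scale c e \<in> U" "w - scale c' e \<in> U" using sU by blast+
      \<comment> \<open>A complement containing both vectors would contain their difference, a
        nonzero multiple of \<open>e\<close>.\<close>
      from subspace_diff[OF sU(1) this] have "scale (c' - c) e \<in> U"
        by (simp add: scale_left_diff_distrib)
      from subspace_scale[OF sU(1) this, of "inverse (c' - c)"] show False
        using sU(4) \<open>c \<noteq> c'\<close> by simp
    qed
  qed
  moreover have "finite (hyperplanes_avoiding e P (V c))" for c
    using fin(2) by (rule finite_hyperplanes_avoiding)
  ultimately have "card (\<Union>c. hyperplanes_avoiding e P (V c)) = CARD('a) ^ Suc d"
    using card_UN_disjoint'[of "\<lambda>c. hyperplanes_avoiding e P (V c)" UNIV, OF _ _ fin(1)] by simp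
  then show ?case
    using hyperplanes_avoiding_UN[OF P(2,1) fin(2) w(1), of U\<^sub>0] by (simp add: V_def)
qed

end

section \<open>Gaussian coefficients\<close>

lemma gauss_neg [simp]: "l < 0 \<Longrightarrow> gauss l m q = 0"
  by (simp add: gauss_def)

lemma gauss_0 [simp]: "gauss 0 m q = 1"
  by (simp add: gauss_def)

text \<open>For \<open>l > 0\<close>, taking out the common factors leaves q^(m+1) - 1 = (q^l - 1) +
  q^l (q^(m-l+1) - 1). The sign of \<open>m\<close> is arbitrary because the closed form involves
  negative lower indices.\<close>

lemma gauss_pascal:
  fixes q :: real
  assumes "q > 1"
  shows "gauss l (m + 1) q = gauss (l - 1) m q + q powi l * gauss l m q"
proof (cases "l > 0")
  case True
  then obtain k where l: "l = int (Suc k)"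
    using zero_less_imp_eq_int[OF True] gr0_implies_Suc by blast
  define N where "N = (\<Prod>i=0..<k. q powi (m - int i) - 1)"
  define D where "D = (\<Prod>i=1..k. q ^ i - 1)"
  have pow: "q ^ i - 1 \<noteq> 0" if "i > 0" for i
    using one_less_power[OF assms that] by simp
  then have D: "D \<noteq> 0" "q ^ Suc k - 1 \<noteq> 0"
    by (auto simp: D_def simp del: power_Suc)
  have "(\<Prod>i=0..<Suc k. q powi (m + 1 - int i) - 1) = (q powi (m + 1) - 1) * N"
    by (subst prod.atLeast0_lessThan_Suc_shift) (simp add: N_def)
  moreover have "(\<Prod>i=0..<Suc k. q powi (m - int i) - 1) = N * (q powi (m - int k) - 1)"
    by (simp add: N_def)
  moreover have "(\<Prod>i=1..Suc k. q ^ i - 1) = D * (q ^ Suc k - 1)"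
    by (simp add: D_def)
  ultimately have G: "gauss l (m + 1) q = (q powi (m + 1) - 1) * N / (D * (q ^ Suc k - 1))"
      "gauss l m q = N * (q powi (m - int k) - 1) / (D * (q ^ Suc k - 1))"
      "gauss (l - 1) m q = N / D"
    by (auto simp: gauss_def l N_def D_def nat_add_distrib simp del: prod.op_ivl_Suc prod.cl_ivl_Suc power_Suc)
  have "q powi (int (Suc k) + (m - int k)) = q powi int (Suc k) * q powi (m - int k)"
    using assms by (intro power_int_add) auto
  then have X: "q powi (m + 1) = q ^ Suc k * q powi (m - int k)"
    by (simp only: power_int_of_nat) (simp add: algebra_simps)
  have alg: "(Y * X - 1) * N / (D * (Y - 1)) = N / D + Y * (N * (X - 1) / (D * (Y - 1)))"
    if "Y - 1 \<noteq> 0" for X Y :: real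
  proof -
    have "N / D = N * (Y - 1) / (D * (Y - 1))" using that by simp
    then show ?thesis
      by (simp only: times_divide_eq_right add_divide_distrib[symmetric]) (simp add: algebra_simps)
  qed
  show ?thesis
    unfolding G X using alg[OF D(2)] by (simp only: l power_int_of_nat)
qed (cases "l = 0"; simp)

text \<open>The factor with \<open>i = nat m\<close> is q^0 - 1. For negative \<open>m\<close> and q
  > 1 no factor vanishes, so the boundary cases of the closed form need separate care.\<close>

lemma gauss_eq_0:
  assumes "0 \<le> m" "m < l"
  shows "gauss l m q = 0"
proof -
  have "(\<Prod>i=0..<nat l. q powi (m - int i) - 1) = 0"
    using assms by (intro prod_zero bexI[of _ "nat m"]) auto
  then show ?thesis
    by (simp add: gauss_def)
qed

lemma gauss_self:
  fixes q :: real
  assumes "q > 1" "0 \<le> l"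
  shows "gauss l l q = 1"
  using assms(2)
proof (induction l rule: int_ge_induct)
  case (step l)
  then show ?case
    using gauss_pascal[OF assms(1), of "l + 1" l] by (simp add: gauss_eq_0)
qed simp

section \<open>Truncation of coordinates\<close>

lemma finite_kvec: "finite (kvec n :: (nat \<Rightarrow> 'k::{field,finite}) set)"
proof -
  have "card (kvec n :: (nat \<Rightarrow> 'k) set) = CARD('k) ^ card (unit_fun ` {..<n} :: (nat \<Rightarrow> 'k) set)"
    using kv.card_span_independent[of "unit_fun ` {..<n}"]
    by (simp add: independent_unit_fun span_unit_fun)
  \<comment> \<open>Infinite sets have \<open>card\<close> 0, so a positive cardinality proves
    finiteness.\<close>
  then show ?thesis
    by (intro card_ge_0_finite) simp
qed

lemma linear_I_alpha: "Vector_Spaces.linear vscale vscale (I_alpha n)"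
  by unfold_locales (auto simp: I_alpha_def vscale_def fun_eq_iff)

lemma linear_I_beta: "Vector_Spaces.linear vscale vscale (I_beta n)"
  by unfold_locales (auto simp: I_beta_def vscale_def fun_eq_iff)

interpretation I_alpha: Vector_Spaces.linear vscale vscale "I_alpha n" for n
  by (rule linear_I_alpha)

interpretation I_beta: Vector_Spaces.linear vscale vscale "I_beta n" for n
  by (rule linear_I_beta)

lemma unit_fun_kvec [simp]: "unit_fun m \<in> kvec n \<longleftrightarrow> m < n"
  by (auto simp: unit_fun_def kvec_def leI)

lemma kvec_mono: "m \<le> n \<Longrightarrow> kvec m \<subseteq> kvec n"
  by (auto simp: kvec_def)

lemma I_alpha_in_kvec [simp]: "I_alpha n x \<in> kvec n"
  by (auto simp: I_alpha_def kvec_def)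

lemma I_beta_in_kvec [simp]: "I_beta n x \<in> kvec n"
  by (auto simp: I_beta_def kvec_def)

lemma I_alpha_id: "x \<in> kvec n \<Longrightarrow> I_alpha n x = x"
  by (auto simp: I_alpha_def kvec_def fun_eq_iff)

lemma I_alpha_unit_fun [simp]: "I_alpha n (unit_fun n) = 0"
  by (auto simp: I_alpha_def unit_fun_def fun_eq_iff)

lemma I_beta_unit_fun [simp]: "I_beta n (unit_fun n) = (if n = 0 then 0 else unit_fun (n - 1))"
  by (auto simp: I_beta_def unit_fun_def fun_eq_iff)

text \<open>Truncating both components is a module homomorphism from \<open>I_(n+1)\<close> to
  \<open>I_n\<close>. The maps alpha are truncations themselves, so only beta has to be
  checked.\<close>

lemma I_alpha_Suc_beta:
  "I_alpha n (I_beta (Suc n) x) = I_beta n (I_alpha (Suc n) x)"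
  by (auto simp: I_alpha_def I_beta_def fun_eq_iff)

lemma diff_I_alpha: "x \<in> kvec (Suc n) \<Longrightarrow> x - I_alpha n x = vscale (x n) (unit_fun n)"
  by (auto simp: I_alpha_def kvec_def unit_fun_def vscale_def fun_eq_iff)

section \<open>Preimages and images of subspaces under truncation\<close>

text \<open>The preimage under truncation. For subspaces \<open>W\<close> of \<open>kvec n\<close>
  these are exactly the subspaces of \<open>kvec (Suc n)\<close> that contain the kernel vector
  \<open>unit_fun n\<close>.\<close>

definition lift :: "nat \<Rightarrow> (nat \<Rightarrow> 'k::field) set \<Rightarrow> (nat \<Rightarrow> 'k) set" where
  "lift n W = {x \<in> kvec (Suc n). I_alpha n x \<in> W}"

lemma lift_subset: "lift n W \<subseteq> kvec (Suc n)"
  by (auto simp: lift_def)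

lemma subspace_lift: "kv.subspace W \<Longrightarrow> kv.subspace (lift n W)"
  by (auto simp: lift_def kv.subspace_def I_alpha.zero I_alpha.add I_alpha.scale kv.subspace_0[OF subspace_kvec]
      kv.subspace_add[OF subspace_kvec] kv.subspace_scale[OF subspace_kvec])

lemma unit_fun_in_lift: "kv.subspace W \<Longrightarrow> unit_fun n \<in> lift n W"
  by (auto simp: lift_def kv.subspace_0)

lemma I_alpha_image_lift:
  assumes "W \<subseteq> kvec n"
  shows "I_alpha n ` lift n W = W"
proof
  show "W \<subseteq> I_alpha n ` lift n W"
  proof
    fix x assume "x \<in> W"
    moreover from this have "I_alpha n x = x" "x \<in> kvec (Suc n)"
      using assms I_alpha_id kvec_mono[of n "Suc n"] by auto
    ultimately show "x \<in> I_alpha n ` lift n W"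
      by (intro image_eqI[of _ _ x]) (auto simp: lift_def)
  qed
qed (auto simp: lift_def)

text \<open>Vectors with equal truncation differ by a multiple of \<open>unit_fun n\<close>, which
  \<open>U\<close> contains.\<close>

lemma lift_I_alpha_image:
  assumes "kv.subspace U" "U \<subseteq> kvec (Suc n)" "unit_fun n \<in> U"
  shows "lift n (I_alpha n ` U) = U"
proof
  show "lift n (I_alpha n ` U) \<subseteq> U"
  proof
    fix x assume "x \<in> lift n (I_alpha n ` U)"
    then obtain u where u: "u \<in> U" "x \<in> kvec (Suc n)" "I_alpha n x = I_alpha n u"
      by (auto simp: lift_def)
    have *: "vscale c (unit_fun n) \<in> U" for c
      using assms kv.subspace_scale by blast
    have "x = u + (vscale (x n) (unit_fun n) - vscale (u n) (unit_fun n))"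
      using u assms(2) by (subst (1 2) diff_I_alpha[symmetric]) auto
    then show "x \<in> U"
      using u(1) * assms(1) kv.subspace_add kv.subspace_diff by metis
  qed
qed (use assms in \<open>auto simp: lift_def\<close>)

text \<open>An element of the preimage is given by its coordinate \<open>n\<close>, which is
  arbitrary, and its truncation in \<open>W\<close>.\<close>

lemma card_lift:
  assumes "W \<subseteq> kvec n"
  shows "card (lift n W :: (nat \<Rightarrow> 'k::{field,finite}) set) = CARD('k) * card W"
proof -
  have "bij_betw (\<lambda>x. (x n, I_alpha n x)) (lift n W) (UNIV \<times> W)"
  proof (rule bij_betw_byWitness[where f' = "\<lambda>(c, x). x(n := c)"])
    show "\<forall>x\<in>lift n W. (case (x n, I_alpha n x) of (c, x) \<Rightarrow> x(n := c)) = x"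
      by (auto simp: lift_def kvec_def I_alpha_def fun_eq_iff)
    show "\<forall>y\<in>UNIV \<times> W. ((case y of (c, x) \<Rightarrow> x(n := c)) n, I_alpha n (case y of (c, x) \<Rightarrow> x(n := c))) = y"
      using assms by (force simp: kvec_def I_alpha_def fun_eq_iff)
    show "(\<lambda>(c, x). x(n := c)) ` (UNIV \<times> W) \<subseteq> lift n W"
    proof clarsimp
      fix c w assume w: "w \<in> W"
      then have "I_alpha n (w(n := c)) = w"
        using assms by (auto simp: kvec_def I_alpha_def fun_eq_iff)
      moreover have "w(n := c) \<in> kvec (Suc n)"
        using w assms by (auto simp: kvec_def)
      ultimately show "w(n := c) \<in> lift n W" using w by (simp add: lift_def)
    qed
  qed (auto simp: lift_def)
  from bij_betw_same_card[OF this] show ?thesis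
    by (simp add: card_cartesian_product)
qed

lemma I_alpha_eq_imp:
  assumes "x \<in> kvec (Suc n)" "y \<in> kvec (Suc n)" "I_alpha n x = I_alpha n y"
  shows "x = y + vscale (x n - y n) (unit_fun n)"
proof -
  have "x - y = vscale (x n) (unit_fun n) - vscale (y n) (unit_fun n)"
    using assms by (subst (1 2) diff_I_alpha[symmetric]) auto
  then show ?thesis
    by (simp add: kv.scale_left_diff_distrib algebra_simps)
qed

text \<open>The kernel of truncation is the line through \<open>unit_fun n\<close>, which meets
  \<open>U\<close> only in 0.\<close>

lemma inj_on_I_alpha:
  assumes "kv.subspace U" "U \<subseteq> kvec (Suc n)" "unit_fun n \<notin> U"
  shows "inj_on (I_alpha n) U"
proof (rule inj_onI)
  fix x y assume xy: "x \<in> U" "y \<in> U" "I_alpha n x = I_alpha n y"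
  define c where "c = x n - y n"
  have x: "x = y + vscale c (unit_fun n)"
    unfolding c_def using xy assms by (intro I_alpha_eq_imp) auto
  then have "vscale c (unit_fun n) \<in> U"
    using xy assms(1) kv.subspace_diff[of U x y] by simp
  then have "c \<noteq> 0 \<Longrightarrow> vscale (inverse c) (vscale c (unit_fun n)) \<in> U"
    using assms(1) kv.subspace_scale by blast
  then show "x = y"
    using x assms(3) by (cases "c = 0") auto
qed

lemma dim_eqI:
  fixes U :: "(nat \<Rightarrow> 'k::{field,finite}) set"
  assumes "kv.subspace U" "U \<subseteq> kvec n" "card U = CARD('k) ^ d"
  shows "kv.dim U = d"
  using assms finite_subset[OF _ finite_kvec] by (intro kv.dim_eq_if_card_eq) auto

lemma card_subspace_kvec:
  fixes U :: "(nat \<Rightarrow> 'k::{field,finite}) set"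
  assumes "kv.subspace U" "U \<subseteq> kvec n"
  shows "card U = CARD('k) ^ kv.dim U"
  using assms finite_subset[OF _ finite_kvec] by (intro kv.card_subspace_eq) auto

lemma dim_lift:
  fixes W :: "(nat \<Rightarrow> 'k::{field,finite}) set"
  assumes "kv.subspace W" "W \<subseteq> kvec n"
  shows "kv.dim (lift n W) = Suc (kv.dim W)"
  using assms lift_subset
  by (intro dim_eqI[of _ "Suc n"]) (auto simp: subspace_lift card_lift card_subspace_kvec[of W n])

lemma dim_I_alpha_image:
  fixes U :: "(nat \<Rightarrow> 'k::{field,finite}) set"
  assumes "kv.subspace U" "U \<subseteq> kvec (Suc n)" "unit_fun n \<notin> U"
  shows "kv.dim (I_alpha n ` U) = kv.dim U"
  using assms
  by (intro dim_eqI[of _ n])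
     (auto simp: I_alpha.subspace_image card_image inj_on_I_alpha card_subspace_kvec[of U "Suc n"])

lemma dim_eq_Suc_I_alpha_image:
  fixes U :: "(nat \<Rightarrow> 'k::{field,finite}) set"
  assumes "kv.subspace U" "U \<subseteq> kvec (Suc n)" "unit_fun n \<in> U"
  shows "kv.dim U = Suc (kv.dim (I_alpha n ` U))"
proof -
  have "kv.dim (lift n (I_alpha n ` U)) = Suc (kv.dim (I_alpha n ` U))"
    using assms by (intro dim_lift I_alpha.subspace_image) auto
  then show ?thesis using assms by (simp add: lift_I_alpha_image)
qed

text \<open>Connects the count of complements with truncation. By \<open>card_lift\<close> the
  cardinality condition says \<open>card U = card W\<close>; since truncation is injective on
  \<open>U\<close>, this means that it maps \<open>U\<close> onto \<open>W\<close>.\<close>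

lemma hyperplanes_avoiding_lift_iff:
  fixes U :: "(nat \<Rightarrow> 'k::{field,finite}) set"
  assumes "W \<subseteq> kvec n"
  shows "U \<in> kv.hyperplanes_avoiding (unit_fun n) (lift n W) U\<^sub>0 \<longleftrightarrow>
    kv.subspace U \<and> U\<^sub>0 \<subseteq> U \<and> U \<subseteq> kvec (Suc n) \<and> unit_fun n \<notin> U \<and> I_alpha n ` U = W"
    (is "?L \<longleftrightarrow> ?R")
proof
  assume U: ?L
  then have U': "kv.subspace U" "U\<^sub>0 \<subseteq> U" "U \<subseteq> lift n W" "unit_fun n \<notin> U" "card U = card W"
    using assms by (auto simp: kv.hyperplanes_avoiding_def card_lift)
  have U'': "U \<subseteq> kvec (Suc n)" using U' lift_subset by blast
  have "I_alpha n ` U = W"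
  proof (rule card_subset_eq)
    show "finite W" using assms finite_kvec finite_subset by blast
    show "I_alpha n ` U \<subseteq> W" using U' by (auto simp: lift_def)
    show "card (I_alpha n ` U) = card W"
      using U' U'' by (simp add: card_image inj_on_I_alpha)
  qed
  then show ?R using U' U'' by blast
next
  assume U: ?R
  then have "card U = card W"
    using card_image[OF inj_on_I_alpha[of U n]] by simp
  moreover have "U \<subseteq> lift n W" using U by (auto simp: lift_def)
  ultimately show ?L
    using U assms by (simp add: kv.hyperplanes_avoiding_def card_lift)
qed

section \<open>Submodules of preinjective modules\<close>

text \<open>
  Copies of the locale constants: inside those, the simplifier rewrites the parameter \<open>n + 1\<close> to
  \<open>Suc n\<close>, after which facts about \<open>preinj\<close> no longer apply.
\<close>

definition preinj_sub :: "nat \<Rightarrow> (nat \<Rightarrow> 'k::field) set \<Rightarrow> (nat \<Rightarrow> 'k) set \<Rightarrow> bool" where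
  "preinj_sub n U\<^sub>1 U\<^sub>2 \<longleftrightarrow> kv.subspace U\<^sub>1 \<and> U\<^sub>1 \<subseteq> kvec n \<and> kv.subspace U\<^sub>2 \<and>
     U\<^sub>2 \<subseteq> kvec (Suc n) \<and> (\<forall>x\<in>U\<^sub>2. I_alpha n x \<in> U\<^sub>1 \<and> I_beta n x \<in> U\<^sub>1)"

definition preinj_Gr :: "nat \<Rightarrow> int \<Rightarrow> int \<Rightarrow> ((nat \<Rightarrow> 'k::field) set \<times> (nat \<Rightarrow> 'k) set) set" where
  "preinj_Gr n a b =
     {(U\<^sub>1, U\<^sub>2). preinj_sub n U\<^sub>1 U\<^sub>2 \<and> int (kv.dim U\<^sub>1) = a \<and> int (kv.dim U\<^sub>2) = b}"

lemma submodule_iff_preinj_sub: "preinj.submodule n U\<^sub>1 U\<^sub>2 \<longleftrightarrow> preinj_sub n U\<^sub>1 U\<^sub>2"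
proof -
  have "I_alpha n ` U\<^sub>2 + I_beta n ` U\<^sub>2 \<subseteq> U\<^sub>1 \<longleftrightarrow> (\<forall>x\<in>U\<^sub>2. I_alpha n x \<in> U\<^sub>1 \<and> I_beta n x \<in> U\<^sub>1)"
    if "kv.subspace U\<^sub>1" "kv.subspace U\<^sub>2"
  proof
    assume *: "I_alpha n ` U\<^sub>2 + I_beta n ` U\<^sub>2 \<subseteq> U\<^sub>1"
    have 0: "0 \<in> U\<^sub>2" using that kv.subspace_0 by blast
    show "\<forall>x\<in>U\<^sub>2. I_alpha n x \<in> U\<^sub>1 \<and> I_beta n x \<in> U\<^sub>1"
    proof
      fix x assume x: "x \<in> U\<^sub>2"
      \<comment> \<open>Pairing \<open>x\<close> with 0 isolates each image inside the set
        sum.\<close>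
      have "I_alpha n x + I_beta n 0 \<in> U\<^sub>1" "I_alpha n 0 + I_beta n x \<in> U\<^sub>1"
        using * 0 x by (blast intro: set_plus_intro)+
      then show "I_alpha n x \<in> U\<^sub>1 \<and> I_beta n x \<in> U\<^sub>1"
        by (simp add: I_alpha.zero I_beta.zero)
    qed
  next
    assume "\<forall>x\<in>U\<^sub>2. I_alpha n x \<in> U\<^sub>1 \<and> I_beta n x \<in> U\<^sub>1"
    then show "I_alpha n ` U\<^sub>2 + I_beta n ` U\<^sub>2 \<subseteq> U\<^sub>1"
      by (auto elim!: set_plus_elim intro!: kv.subspace_add[OF that(1)])
  qed
  then show ?thesis
    unfolding preinj.submodule_def preinj_sub_def Suc_eq_plus1 by blast
qed

lemma Gr_eq_preinj_Gr: "preinj.Gr n a b = preinj_Gr n a b"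
  unfolding preinj.Gr_def preinj_Gr_def submodule_iff_preinj_sub ..

lemma preinj_Gr_iff:
  "(U\<^sub>1, U\<^sub>2) \<in> preinj_Gr n a b \<longleftrightarrow>
     preinj_sub n U\<^sub>1 U\<^sub>2 \<and> int (kv.dim U\<^sub>1) = a \<and> int (kv.dim U\<^sub>2) = b"
  by (simp add: preinj_Gr_def)

lemma finite_preinj_Gr: "finite (preinj_Gr n a b :: ((nat \<Rightarrow> 'k::{field,finite}) set \<times> _) set)"
proof (rule finite_subset)
  show "preinj_Gr n a b \<subseteq> Pow (kvec n) \<times> Pow (kvec (Suc n))"
    by (auto simp: preinj_Gr_iff preinj_sub_def)
qed (simp add: finite_kvec)

lemma preinj_sub_lift:
  assumes "preinj_sub n W\<^sub>1 W\<^sub>2"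
  shows "preinj_sub (Suc n) (lift n W\<^sub>1) (lift (Suc n) W\<^sub>2)"
proof -
  have "I_alpha (Suc n) x \<in> lift n W\<^sub>1 \<and> I_beta (Suc n) x \<in> lift n W\<^sub>1" if "x \<in> lift (Suc n) W\<^sub>2" for x
    using assms that by (auto simp: preinj_sub_def lift_def I_alpha_Suc_beta)
  then show ?thesis
    using assms lift_subset unfolding preinj_sub_def by (auto simp: subspace_lift)
qed

lemma preinj_sub_I_alpha_image:
  assumes "preinj_sub (Suc n) U\<^sub>1 U\<^sub>2"
  shows "preinj_sub n (I_alpha n ` U\<^sub>1) (I_alpha (Suc n) ` U\<^sub>2)"
  using assms unfolding preinj_sub_def
  by (auto simp: I_alpha.subspace_image I_alpha_Suc_beta[symmetric])

section \<open>Recursions for the numbers of submodules\<close>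

text \<open>Such a submodule contains the whole kernel of the truncation from \<open>I_(n+1)\<close>
  to \<open>I_n\<close>, so it corresponds to a submodule of the quotient \<open>I_n\<close>, with
  both dimensions lowered by one.\<close>

lemma card_preinj_Gr_unit_fun_in:
  "card {U \<in> preinj_Gr (Suc n) a b :: ((nat \<Rightarrow> 'k::{field,finite}) set \<times> _) set. unit_fun (Suc n) \<in> snd U} =
   card (preinj_Gr n (a - 1) (b - 1) :: ((nat \<Rightarrow> 'k) set \<times> _) set)" (is "card ?S = card ?T")
proof -
  have "bij_betw (\<lambda>(W\<^sub>1, W\<^sub>2). (lift n W\<^sub>1, lift (Suc n) W\<^sub>2)) ?T ?S"
  proof (rule bij_betw_byWitness[where f' = "\<lambda>(U\<^sub>1, U\<^sub>2). (I_alpha n ` U\<^sub>1, I_alpha (Suc n) ` U\<^sub>2)"])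
    \<comment> \<open>beta sends \<open>unit_fun (Suc n)\<close> to
      \<open>unit_fun n\<close>.\<close>
    have un: "unit_fun n \<in> U\<^sub>1"
      if "preinj_sub (Suc n) U\<^sub>1 U\<^sub>2" "unit_fun (Suc n) \<in> U\<^sub>2" for U\<^sub>1 U\<^sub>2 :: "(nat \<Rightarrow> 'k) set"
      using that by (auto simp: preinj_sub_def dest!: bspec[of U\<^sub>2 _ "unit_fun (Suc n)"])
    show "\<forall>W\<in>?T. (case case W of (W\<^sub>1, W\<^sub>2) \<Rightarrow> (lift n W\<^sub>1, lift (Suc n) W\<^sub>2) of
        (U\<^sub>1, U\<^sub>2) \<Rightarrow> (I_alpha n ` U\<^sub>1, I_alpha (Suc n) ` U\<^sub>2)) = W"
      by (clarsimp simp: preinj_Gr_iff preinj_sub_def I_alpha_image_lift)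
    show "\<forall>U\<in>?S. (case case U of (U\<^sub>1, U\<^sub>2) \<Rightarrow> (I_alpha n ` U\<^sub>1, I_alpha (Suc n) ` U\<^sub>2) of
        (W\<^sub>1, W\<^sub>2) \<Rightarrow> (lift n W\<^sub>1, lift (Suc n) W\<^sub>2)) = U"
      using un by (auto simp: preinj_Gr_iff) (auto simp: preinj_sub_def lift_I_alpha_image)
    show "(\<lambda>(W\<^sub>1, W\<^sub>2). (lift n W\<^sub>1, lift (Suc n) W\<^sub>2)) ` ?T \<subseteq> ?S"
      by (auto simp: preinj_Gr_iff preinj_sub_lift) (auto simp: preinj_sub_def dim_lift unit_fun_in_lift)
    show "(\<lambda>(U\<^sub>1, U\<^sub>2). (I_alpha n ` U\<^sub>1, I_alpha (Suc n) ` U\<^sub>2)) ` ?S \<subseteq> ?T"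
    proof (clarsimp simp: preinj_Gr_iff preinj_sub_I_alpha_image)
      fix U\<^sub>1 U\<^sub>2 :: "(nat \<Rightarrow> 'k) set"
      assume U: "preinj_sub (Suc n) U\<^sub>1 U\<^sub>2" "unit_fun (Suc n) \<in> U\<^sub>2"
      show "int (kv.dim (I_alpha n ` U\<^sub>1)) = int (kv.dim U\<^sub>1) - 1 \<and>
          int (kv.dim (I_alpha (Suc n) ` U\<^sub>2)) = int (kv.dim U\<^sub>2) - 1"
        using U un[OF U] dim_eq_Suc_I_alpha_image[of U\<^sub>1 n] dim_eq_Suc_I_alpha_image[of U\<^sub>2 "Suc n"]
        by (auto simp: preinj_sub_def)
    qed
  qed
  from bij_betw_same_card[OF this] show ?thesis by simp
qed

text \<open>The submodules counted by \<open>B\<^sub>n\<close> in the overview.\<close>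

definition preinj_Gr_inj :: "nat \<Rightarrow> int \<Rightarrow> int \<Rightarrow> ((nat \<Rightarrow> 'k::field) set \<times> (nat \<Rightarrow> 'k) set) set" where
  "preinj_Gr_inj n a b = {U \<in> preinj_Gr n a b. unit_fun n \<notin> snd U}"

lemma finite_preinj_Gr_inj: "finite (preinj_Gr_inj n a b :: ((nat \<Rightarrow> 'k::{field,finite}) set \<times> _) set)"
  by (simp add: preinj_Gr_inj_def finite_preinj_Gr)

lemma card_preinj_Gr_Suc:
  "card (preinj_Gr (Suc n) a b :: ((nat \<Rightarrow> 'k::{field,finite}) set \<times> _) set) =
   card (preinj_Gr n (a - 1) (b - 1) :: ((nat \<Rightarrow> 'k) set \<times> _) set) +
   card (preinj_Gr_inj (Suc n) a b :: ((nat \<Rightarrow> 'k) set \<times> _) set)"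
proof -
  have "card {U \<in> preinj_Gr (Suc n) a b :: ((nat \<Rightarrow> 'k) set \<times> _) set. unit_fun (Suc n) \<in> snd U} +
    card (preinj_Gr_inj (Suc n) a b :: ((nat \<Rightarrow> 'k) set \<times> _) set) =
    card (preinj_Gr (Suc n) a b :: ((nat \<Rightarrow> 'k) set \<times> _) set)"
    unfolding preinj_Gr_inj_def
    by (subst card_Un_disjoint[symmetric]) (auto simp: finite_preinj_Gr intro!: arg_cong[where f = card])
  then show ?thesis by (simp add: card_preinj_Gr_unit_fun_in)
qed

text \<open>Here \<open>U\<^sub>1\<close> is the full preimage of its image
  \<open>W\<^sub>1\<close>. The preimages of \<open>W\<^sub>1\<close> and \<open>W\<^sub>2\<close>
  form a submodule, so every complement of the kernel line in the preimage of
  \<open>W\<^sub>2\<close> may serve as \<open>U\<^sub>2\<close>.\<close>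

lemma card_preinj_Gr_inj_unit_fun_in:
  "card {U \<in> preinj_Gr_inj (Suc n) a (int b) :: ((nat \<Rightarrow> 'k::{field,finite}) set \<times> _) set. unit_fun n \<in> fst U} =
   CARD('k) ^ b * card (preinj_Gr n (a - 1) (int b) :: ((nat \<Rightarrow> 'k) set \<times> _) set)"
  (is "card ?S = _ * card ?T")
proof -
  let ?H = "\<lambda>W. kv.hyperplanes_avoiding (unit_fun (Suc n)) (lift (Suc n) (snd W)) {0}
      :: (nat \<Rightarrow> 'k) set set"
  let ?f = "\<lambda>(W, U\<^sub>2). (lift n (fst W), U\<^sub>2)"
  have sub: "W\<^sub>1 \<subseteq> kvec n" "W\<^sub>2 \<subseteq> kvec (Suc n)" "kv.subspace W\<^sub>2" if "(W\<^sub>1, W\<^sub>2) \<in> ?T" for W\<^sub>1 W\<^sub>2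
    using that by (auto simp: preinj_Gr_iff preinj_sub_def)
  have inj: "inj_on ?f (Sigma ?T ?H)"
    by (rule inj_on_inverseI[where g = "\<lambda>(U\<^sub>1, U\<^sub>2). ((I_alpha n ` U\<^sub>1, I_alpha (Suc n) ` U\<^sub>2), U\<^sub>2)"])
      (clarsimp simp: sub I_alpha_image_lift hyperplanes_avoiding_lift_iff)
  have image: "?f ` Sigma ?T ?H = ?S"
  proof (intro equalityI subsetI)
    fix U assume "U \<in> ?f ` Sigma ?T ?H"
    then obtain W\<^sub>1 W\<^sub>2 U\<^sub>2 where U: "U = (lift n W\<^sub>1, U\<^sub>2)" and W: "(W\<^sub>1, W\<^sub>2) \<in> ?T" and U2: "U\<^sub>2 \<in> ?H (W\<^sub>1, W\<^sub>2)"
      by auto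
    have H: "kv.subspace U\<^sub>2" "U\<^sub>2 \<subseteq> kvec (Suc (Suc n))" "unit_fun (Suc n) \<notin> U\<^sub>2" "I_alpha (Suc n) ` U\<^sub>2 = W\<^sub>2"
      using U2 sub[OF W] by (auto simp: hyperplanes_avoiding_lift_iff)
    have "U\<^sub>2 \<subseteq> lift (Suc n) W\<^sub>2"
      using U2 by (simp add: kv.hyperplanes_avoiding_def)
    then have "preinj_sub (Suc n) (lift n W\<^sub>1) U\<^sub>2"
      using W H preinj_sub_lift[of n W\<^sub>1 W\<^sub>2] by (auto simp: preinj_Gr_iff) (auto simp: preinj_sub_def)
    moreover have "kv.dim U\<^sub>2 = kv.dim W\<^sub>2" "kv.dim (lift n W\<^sub>1) = Suc (kv.dim W\<^sub>1)" "unit_fun n \<in> lift n W\<^sub>1"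
      using W H dim_I_alpha_image[of U\<^sub>2 "Suc n"]
      by (auto simp: preinj_Gr_iff preinj_sub_def dim_lift unit_fun_in_lift)
    ultimately show "U \<in> ?S"
      using W H by (auto simp: U preinj_Gr_inj_def preinj_Gr_iff)
  next
    fix U assume "U \<in> ?S"
    then obtain U\<^sub>1 U\<^sub>2 where U: "U = (U\<^sub>1, U\<^sub>2)" "(U\<^sub>1, U\<^sub>2) \<in> preinj_Gr (Suc n) a (int b)"
      "unit_fun (Suc n) \<notin> U\<^sub>2" "unit_fun n \<in> U\<^sub>1"
      by (cases U) (auto simp: preinj_Gr_inj_def)
    then have s: "preinj_sub (Suc n) U\<^sub>1 U\<^sub>2" by (simp add: preinj_Gr_iff)
    then have s': "kv.subspace U\<^sub>1" "U\<^sub>1 \<subseteq> kvec (Suc n)" "kv.subspace U\<^sub>2" "U\<^sub>2 \<subseteq> kvec (Suc (Suc n))"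
      by (auto simp: preinj_sub_def)
    have W: "(I_alpha n ` U\<^sub>1, I_alpha (Suc n) ` U\<^sub>2) \<in> ?T"
      using U s s' dim_I_alpha_image[of U\<^sub>2 "Suc n"] dim_eq_Suc_I_alpha_image[of U\<^sub>1 n]
      by (auto simp: preinj_Gr_iff preinj_sub_I_alpha_image)
    moreover have "U\<^sub>2 \<in> ?H (I_alpha n ` U\<^sub>1, I_alpha (Suc n) ` U\<^sub>2)"
      using U s' sub[OF W] kv.subspace_0 by (auto simp: hyperplanes_avoiding_lift_iff)
    ultimately show "U \<in> ?f ` Sigma ?T ?H"
      using U s' by (intro image_eqI[of _ _ "((I_alpha n ` U\<^sub>1, I_alpha (Suc n) ` U\<^sub>2), U\<^sub>2)"])
        (auto simp: lift_I_alpha_image)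
  qed
  have "card ?S = card (Sigma ?T ?H)"
    using card_image[OF inj] by (simp only: image)
  also have "\<dots> = (\<Sum>W\<in>?T. card (?H W))"
  proof (rule card_SigmaI)
    show "\<forall>W\<in>?T. finite (?H W)"
      using kv.finite_hyperplanes_avoiding[OF finite_subset[OF lift_subset finite_kvec]] by blast
  qed (rule finite_preinj_Gr)
  also have "\<dots> = (\<Sum>W\<in>?T. CARD('k) ^ b)"
  proof (rule sum.cong, simp, clarify)
    fix W\<^sub>1 W\<^sub>2 assume W: "(W\<^sub>1, W\<^sub>2) \<in> ?T"
    then have "kv.dim W\<^sub>2 = b" by (auto simp: preinj_Gr_iff)
    \<comment> \<open>The preimage of \<open>W\<^sub>2\<close> has dimension b + 1. The lower bound
      \<open>{0}\<close> imposes no condition, so there are q^b complements.\<close>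
    then have "card (lift (Suc n) W\<^sub>2) = CARD('k) ^ Suc b * card {0::nat \<Rightarrow> 'k}"
      using sub[OF W] by (simp add: card_lift card_subspace_kvec[of _ "Suc n"])
    moreover have "unit_fun (Suc n) \<noteq> (0 :: nat \<Rightarrow> 'k)"
      by (auto simp: unit_fun_def fun_eq_iff)
    moreover have "finite (lift (Suc n) W\<^sub>2)"
      by (rule finite_subset[OF lift_subset finite_kvec])
    ultimately show "card (?H (W\<^sub>1, W\<^sub>2)) = CARD('k) ^ b"
      using sub[OF W] unit_fun_in_lift[of W\<^sub>2 "Suc n"] subspace_lift[of W\<^sub>2 "Suc n"]
      by (intro kv.card_hyperplanes_avoiding) (auto intro: kv.subspace_0)
  qed
  finally show ?thesis by simp
qed

text \<open>The ambiguity in lifting a vector along alpha shifts its image under beta by the same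
  multiple of \<open>unit_fun n\<close>. Hence prescribing beta modulo a complement of that line
  removes the ambiguity.\<close>

lemma I_alpha_eq_imp_I_beta:
  assumes "x \<in> kvec (Suc (Suc n))" "y \<in> kvec (Suc (Suc n))" "I_alpha (Suc n) x = I_alpha (Suc n) y"
  obtains c where "x = y + vscale c (unit_fun (Suc n))"
    "I_beta (Suc n) x = I_beta (Suc n) y + vscale c (unit_fun n)"
proof -
  define c where "c = x (Suc n) - y (Suc n)"
  have x: "x = y + vscale c (unit_fun (Suc n))"
    unfolding c_def by (intro I_alpha_eq_imp assms)
  then have "I_beta (Suc n) x = I_beta (Suc n) y + vscale c (unit_fun n)"
    by (simp add: I_beta.add I_beta.scale)
  with x that show ?thesis by blast
qed

text \<open>alpha embeds \<open>W\<^sub>2\<close> into \<open>W\<^sub>1\<close>.\<close>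

lemma dim_le_if_unit_fun_notin:
  assumes "preinj_sub n W\<^sub>1 (W\<^sub>2 :: (nat \<Rightarrow> 'k::{field,finite}) set)" "unit_fun n \<notin> W\<^sub>2"
  shows "kv.dim W\<^sub>2 \<le> kv.dim W\<^sub>1"
proof -
  have W: "kv.subspace W\<^sub>1" "W\<^sub>1 \<subseteq> kvec n" "kv.subspace W\<^sub>2" "W\<^sub>2 \<subseteq> kvec (Suc n)" "I_alpha n ` W\<^sub>2 \<subseteq> W\<^sub>1"
    using assms(1) by (auto simp: preinj_sub_def)
  have "card W\<^sub>2 \<le> card W\<^sub>1"
    using card_mono[OF finite_subset[OF W(2) finite_kvec] W(5)] inj_on_I_alpha[OF W(3,4) assms(2)]
    by (simp add: card_image)
  moreover have "CARD('k) > 1"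
    using card_mono[of UNIV "{0, 1 :: 'k}"] by simp
  ultimately show ?thesis
    using W by (simp add: card_subspace_kvec[of W\<^sub>1 n] card_subspace_kvec[of W\<^sub>2 "Suc n"])
qed

text \<open>The image \<open>W\<^sub>2\<close> of \<open>U\<^sub>2\<close> under alpha lies in
  \<open>U\<^sub>1\<close>, so it avoids \<open>unit_fun n\<close>; therefore the truncated module
  is again counted by \<open>preinj_Gr_inj\<close>. For \<open>a < b\<close> both sets are empty, so
  the truncated subtraction is harmless.\<close>

lemma card_preinj_Gr_inj_unit_fun_notin:
  "card {U \<in> preinj_Gr_inj (Suc n) (int a) (int b) :: ((nat \<Rightarrow> 'k::{field,finite}) set \<times> _) set. unit_fun n \<notin> fst U} =
   CARD('k) ^ (a - b) * card (preinj_Gr_inj n (int a) (int b) :: ((nat \<Rightarrow> 'k) set \<times> _) set)"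
  (is "card ?S = _ * card ?T")
proof -
  let ?H = "\<lambda>W. kv.hyperplanes_avoiding (unit_fun n) (lift n (fst W)) (snd W) :: (nat \<Rightarrow> 'k) set set"
  \<comment> \<open>The only candidate for \<open>U\<^sub>2\<close>: each vector of
    \<open>W\<^sub>2\<close> has exactly one preimage that beta sends into
    \<open>U\<^sub>1\<close>.\<close>
  let ?V = "\<lambda>W\<^sub>2 U\<^sub>1. {x \<in> lift (Suc n) W\<^sub>2. I_beta (Suc n) x \<in> U\<^sub>1}"
  let ?f = "\<lambda>(W, U\<^sub>1). (U\<^sub>1, ?V (snd W) U\<^sub>1)"
  have sub: "preinj_sub n W\<^sub>1 W\<^sub>2" "kv.subspace W\<^sub>1" "W\<^sub>1 \<subseteq> kvec n" "kv.subspace W\<^sub>2" "W\<^sub>2 \<subseteq> kvec (Suc n)"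
      "unit_fun n \<notin> W\<^sub>2" "kv.dim W\<^sub>1 = a" "kv.dim W\<^sub>2 = b"
    if "(W\<^sub>1, W\<^sub>2) \<in> ?T" for W\<^sub>1 W\<^sub>2
    using that by (auto simp: preinj_Gr_inj_def preinj_Gr_iff preinj_sub_def)
  have V: "I_alpha (Suc n) ` ?V W\<^sub>2 U\<^sub>1 = W\<^sub>2"
    if W: "(W\<^sub>1, W\<^sub>2) \<in> ?T" and U: "U\<^sub>1 \<in> ?H (W\<^sub>1, W\<^sub>2)" for W\<^sub>1 W\<^sub>2 U\<^sub>1
  proof (intro equalityI subsetI)
    note s = sub[OF W]
    have U': "U\<^sub>1 \<subseteq> kvec (Suc n)" "I_alpha n ` U\<^sub>1 = W\<^sub>1"
      using U s by (auto simp: hyperplanes_avoiding_lift_iff)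
    fix w assume w: "w \<in> W\<^sub>2"
    then have w': "w \<in> kvec (Suc n)" "I_alpha (Suc n) w = w"
      using s I_alpha_id by auto
    have "I_alpha n (I_beta (Suc n) w) = I_beta n w"
      by (simp add: I_alpha_Suc_beta w')
    also have "\<dots> \<in> W\<^sub>1"
      using s(1) w by (auto simp: preinj_sub_def)
    finally obtain u where u: "u \<in> U\<^sub>1" "I_alpha n u = I_alpha n (I_beta (Suc n) w)"
      using U' by auto
    \<comment> \<open>Adding \<open>c\<close> times \<open>unit_fun (Suc n)\<close> to
      \<open>w\<close> keeps the truncation and moves the beta image to \<open>u\<close>.\<close>
    define c where "c = u n - I_beta (Suc n) w n"
    define x where "x = w + vscale c (unit_fun (Suc n))"
    have "u = I_beta (Suc n) w + vscale c (unit_fun n)"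
      unfolding c_def using u U' by (intro I_alpha_eq_imp) auto
    then have "I_beta (Suc n) x = u"
      by (simp add: x_def I_beta.add I_beta.scale)
    moreover have "I_alpha (Suc n) x = w"
      by (simp add: x_def I_alpha.add I_alpha.scale w')
    moreover have "x \<in> kvec (Suc (Suc n))"
      using w' kvec_mono[of "Suc n" "Suc (Suc n)"] unfolding x_def
      by (intro kv.subspace_add[OF subspace_kvec] kv.subspace_scale[OF subspace_kvec]) auto
    ultimately show "w \<in> I_alpha (Suc n) ` ?V W\<^sub>2 U\<^sub>1"
      using u w by (intro image_eqI[of _ _ x]) (auto simp: lift_def)
  qed (auto simp: lift_def)
  have inj: "inj_on ?f (Sigma ?T ?H)"
    by (rule inj_on_inverseI[where g = "\<lambda>(U\<^sub>1, U\<^sub>2). ((I_alpha n ` U\<^sub>1, I_alpha (Suc n) ` U\<^sub>2), U\<^sub>1)"])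
      (clarsimp simp: sub V hyperplanes_avoiding_lift_iff)
  have image: "?f ` Sigma ?T ?H = ?S"
  proof (intro equalityI subsetI)
    fix U assume "U \<in> ?f ` Sigma ?T ?H"
    then obtain W\<^sub>1 W\<^sub>2 U\<^sub>1 where U: "U = (U\<^sub>1, ?V W\<^sub>2 U\<^sub>1)" and W: "(W\<^sub>1, W\<^sub>2) \<in> ?T" and U1: "U\<^sub>1 \<in> ?H (W\<^sub>1, W\<^sub>2)"
      by auto
    note s = sub[OF W]
    have H: "kv.subspace U\<^sub>1" "W\<^sub>2 \<subseteq> U\<^sub>1" "U\<^sub>1 \<subseteq> kvec (Suc n)" "unit_fun n \<notin> U\<^sub>1" "I_alpha n ` U\<^sub>1 = W\<^sub>1"
      using U1 s by (auto simp: hyperplanes_avoiding_lift_iff)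
    have V2: "kv.subspace (?V W\<^sub>2 U\<^sub>1)"
      using kv.subspace_inter[OF subspace_lift[OF s(4), of "Suc n"] I_beta.subspace_vimage[OF H(1), of "Suc n"]]
      by (simp add: vimage_def Int_def)
    have V3: "?V W\<^sub>2 U\<^sub>1 \<subseteq> kvec (Suc (Suc n))" "unit_fun (Suc n) \<notin> ?V W\<^sub>2 U\<^sub>1"
      using H(4) by (auto simp: lift_def)
    have "preinj_sub (Suc n) U\<^sub>1 (?V W\<^sub>2 U\<^sub>1)"
      using H V2 V3 unfolding preinj_sub_def by (auto simp: lift_def)
    moreover have "kv.dim U\<^sub>1 = a" "kv.dim (?V W\<^sub>2 U\<^sub>1) = b"
      using dim_I_alpha_image[OF H(1,3,4)] dim_I_alpha_image[OF V2 V3] s H(5) V[OF W U1] by auto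
    ultimately show "U \<in> ?S"
      using H(4) V3(2) by (simp add: U preinj_Gr_inj_def preinj_Gr_iff)
  next
    fix U assume "U \<in> ?S"
    then obtain U\<^sub>1 U\<^sub>2 where U: "U = (U\<^sub>1, U\<^sub>2)" "(U\<^sub>1, U\<^sub>2) \<in> preinj_Gr (Suc n) (int a) (int b)"
      "unit_fun (Suc n) \<notin> U\<^sub>2" "unit_fun n \<notin> U\<^sub>1"
      by (cases U) (auto simp: preinj_Gr_inj_def)
    then have s: "preinj_sub (Suc n) U\<^sub>1 U\<^sub>2" by (simp add: preinj_Gr_iff)
    then have s': "kv.subspace U\<^sub>1" "U\<^sub>1 \<subseteq> kvec (Suc n)" "kv.subspace U\<^sub>2" "U\<^sub>2 \<subseteq> kvec (Suc (Suc n))"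
      and img: "I_alpha (Suc n) ` U\<^sub>2 \<subseteq> U\<^sub>1" and bimg: "\<And>u. u \<in> U\<^sub>2 \<Longrightarrow> I_beta (Suc n) u \<in> U\<^sub>1"
      by (auto simp: preinj_sub_def)
    let ?W = "(I_alpha n ` U\<^sub>1, I_alpha (Suc n) ` U\<^sub>2)"
    have W: "?W \<in> ?T"
      using U s s' img dim_I_alpha_image[of U\<^sub>2 "Suc n"] dim_I_alpha_image[of U\<^sub>1 n]
      by (auto simp: preinj_Gr_inj_def preinj_Gr_iff preinj_sub_I_alpha_image)
    moreover have "U\<^sub>1 \<in> ?H ?W"
      using U s' img sub[OF W] by (simp add: hyperplanes_avoiding_lift_iff)
    moreover have "?V (I_alpha (Suc n) ` U\<^sub>2) U\<^sub>1 = U\<^sub>2"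
    proof (intro equalityI subsetI)
      fix x assume x: "x \<in> ?V (I_alpha (Suc n) ` U\<^sub>2) U\<^sub>1"
      then obtain u where u: "u \<in> U\<^sub>2" "I_alpha (Suc n) x = I_alpha (Suc n) u" "x \<in> kvec (Suc (Suc n))"
        by (auto simp: lift_def)
      then obtain c where c: "x = u + vscale c (unit_fun (Suc n))"
        "I_beta (Suc n) x = I_beta (Suc n) u + vscale c (unit_fun n)"
        using s'(4) I_alpha_eq_imp_I_beta[of x n u] by blast
      have "I_beta (Suc n) x - I_beta (Suc n) u \<in> U\<^sub>1"
        using x bimg[OF u(1)] by (intro kv.subspace_diff[OF s'(1)]) auto
      \<comment> \<open>The line through \<open>unit_fun n\<close> meets \<open>U\<^sub>1\<close>
        only in 0, so \<open>c = 0\<close> and \<open>x = u\<close>.\<close>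
      then have "vscale c (unit_fun n) \<in> U\<^sub>1" using c(2) by simp
      from kv.subspace_scale[OF s'(1) this, of "inverse c"] have "c = 0"
        using U(4) by (cases "c = 0") auto
      then show "x \<in> U\<^sub>2" using c u by simp
    qed (use s' bimg in \<open>auto simp: lift_def\<close>)
    ultimately show "U \<in> ?f ` Sigma ?T ?H"
      using U by (intro image_eqI[of _ _ "(?W, U\<^sub>1)"]) auto
  qed
  have "card ?S = card (Sigma ?T ?H)"
    using card_image[OF inj] by (simp only: image)
  also have "\<dots> = (\<Sum>W\<in>?T. card (?H W))"
  proof (rule card_SigmaI)
    show "\<forall>W\<in>?T. finite (?H W)"
      using kv.finite_hyperplanes_avoiding[OF finite_subset[OF lift_subset finite_kvec]] by blast
  qed (rule finite_preinj_Gr_inj)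
  also have "\<dots> = (\<Sum>W\<in>?T. CARD('k) ^ (a - b))"
  proof (rule sum.cong, simp, clarify)
    fix W\<^sub>1 W\<^sub>2 assume W: "(W\<^sub>1, W\<^sub>2) \<in> ?T"
    note s = sub[OF W]
    have "b \<le> a"
      using dim_le_if_unit_fun_notin[OF s(1) s(6)] s by simp
    \<comment> \<open>\<open>W\<^sub>2\<close> has codimension a + 1 - b in the preimage of
      \<open>W\<^sub>1\<close>; \<open>b \<le> a\<close> makes the natural subtraction
      exact.\<close>
    then have "card (lift n W\<^sub>1) = CARD('k) ^ Suc (a - b) * card W\<^sub>2"
      using s by (simp add: card_lift card_subspace_kvec[of W\<^sub>1 n] card_subspace_kvec[of W\<^sub>2 "Suc n"]
          power_add[symmetric])
    moreover have "W\<^sub>2 \<subseteq> lift n W\<^sub>1"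
      using s(1,5) by (auto simp: lift_def preinj_sub_def)
    moreover have "finite (lift n W\<^sub>1)"
      by (rule finite_subset[OF lift_subset finite_kvec])
    ultimately show "card (?H (W\<^sub>1, W\<^sub>2)) = CARD('k) ^ (a - b)"
      using s unit_fun_in_lift[of W\<^sub>1 n] subspace_lift[of W\<^sub>1 n]
      by (intro kv.card_hyperplanes_avoiding) auto
  qed
  finally show ?thesis by simp
qed

lemma card_preinj_Gr_inj_Suc:
  fixes a b :: int
  defines "q \<equiv> real CARD('k::{field,finite})"
  shows "real (card (preinj_Gr_inj (Suc n) a b :: ((nat \<Rightarrow> 'k) set \<times> _) set)) =
    q powi b * real (card (preinj_Gr n (a - 1) b :: ((nat \<Rightarrow> 'k) set \<times> _) set)) +
    q powi (a - b) * real (card (preinj_Gr_inj n a b :: ((nat \<Rightarrow> 'k) set \<times> _) set))"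
proof (cases "a < 0 \<or> b < 0")
  case True
  then have "preinj_Gr m c d = ({} :: ((nat \<Rightarrow> 'k) set \<times> _) set)" if "c \<le> a" "d = b" for m c d
    using that by (auto simp: preinj_Gr_def)
  then show ?thesis by (simp add: preinj_Gr_inj_def)
next
  case False
  then obtain a' b' where ab: "a = int a'" "b = int b'"
    by (metis nat_0_le not_less)
  let ?B = "preinj_Gr_inj (Suc n) a b :: ((nat \<Rightarrow> 'k) set \<times> _) set"
  have q: "q \<noteq> 0" by (simp add: q_def)
  have "card ?B = card {U \<in> ?B. unit_fun n \<in> fst U} + card {U \<in> ?B. unit_fun n \<notin> fst U}"
    by (subst card_Un_disjoint[symmetric]) (auto simp: finite_preinj_Gr_inj intro!: arg_cong[where f = card])
  \<comment> \<open>For \<open>a < b\<close> the second summand vanishes, so its negative exponent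
    does not matter.\<close>
  moreover have "preinj_Gr_inj n a b = ({} :: ((nat \<Rightarrow> 'k) set \<times> _) set)" if "a < b"
    using that dim_le_if_unit_fun_notin by (fastforce simp: preinj_Gr_inj_def preinj_Gr_def)
  moreover have "q powi (a - b) = q ^ (a' - b')" if "\<not> a < b"
    using that by (simp add: ab power_int_of_nat[symmetric] of_nat_diff del: power_int_of_nat)
  ultimately show ?thesis
    unfolding ab card_preinj_Gr_inj_unit_fun_in card_preinj_Gr_inj_unit_fun_notin by (cases "a' < b'") (auto simp: ab q_def)
qed

section \<open>The base case and the closed forms\<close>

lemma kvec_0: "kvec 0 = {0}"
  by (auto simp: kvec_def fun_eq_iff)

text \<open>\<open>I_0\<close> has zero first component and a line as second, and a line has only
  the two trivial subspaces.\<close>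

lemma preinj_Gr_0:
  "preinj_Gr 0 a b = (if a = 0 \<and> b = 0 then {({0}, {0})}
     else if a = 0 \<and> b = 1 then {({0}, kvec 1)} else {} :: ((nat \<Rightarrow> 'k::{field,finite}) set \<times> _) set)"
proof -
  have sub: "preinj_sub 0 U\<^sub>1 U\<^sub>2 \<longleftrightarrow> U\<^sub>1 = {0} \<and> (U\<^sub>2 = {0} \<or> U\<^sub>2 = kvec 1)" for U\<^sub>1 U\<^sub>2 :: "(nat \<Rightarrow> 'k) set"
  proof
    assume U: "preinj_sub 0 U\<^sub>1 U\<^sub>2"
    then have U': "kv.subspace U\<^sub>1" "U\<^sub>1 \<subseteq> {0}" "kv.subspace U\<^sub>2" "U\<^sub>2 \<subseteq> kvec 1"
      by (auto simp: preinj_sub_def kvec_0)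
    have "U\<^sub>2 = kvec 1" if nonzero: "U\<^sub>2 \<noteq> {0}"
    proof
      obtain x where x: "x \<in> U\<^sub>2" "x \<noteq> 0"
        using kv.subspace_0[OF U'(3)] nonzero by blast
      have x0: "x 0 \<noteq> 0"
      proof
        assume "x 0 = 0"
        then have "x i = 0" for i
          using x(1) U'(4) by (cases i) (auto simp: kvec_def)
        then show False using x(2) by (simp add: fun_eq_iff)
      qed
      show "kvec 1 \<subseteq> U\<^sub>2"
      proof
        fix y :: "nat \<Rightarrow> 'k" assume y: "y \<in> kvec 1"
        have "y i = vscale (y 0 / x 0) x i" for i
          using x x0 y U'(4) by (cases i) (auto simp: kvec_def vscale_def)
        then have "y = vscale (y 0 / x 0) x" by blast
        then show "y \<in> U\<^sub>2" using kv.subspace_scale[OF U'(3) x(1)] by metis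
      qed
    qed (rule U')
    moreover have "U\<^sub>1 = {0}" using U'(2) kv.subspace_0[OF U'(1)] by blast
    ultimately show "U\<^sub>1 = {0} \<and> (U\<^sub>2 = {0} \<or> U\<^sub>2 = kvec 1)" by blast
  next
    assume "U\<^sub>1 = {0} \<and> (U\<^sub>2 = {0} \<or> U\<^sub>2 = kvec 1)"
    then show "preinj_sub 0 U\<^sub>1 U\<^sub>2"
      using subspace_kvec[of 1] kv.subspace_0[OF subspace_kvec, of 1]
      by (auto simp: preinj_sub_def kvec_0 I_alpha_def I_beta_def fun_eq_iff)
  qed
  have "kv.dim {0 :: nat \<Rightarrow> 'k} = 0" "kv.dim (kvec 1 :: (nat \<Rightarrow> 'k) set) = 1"
    using dim_kvec[of 0] dim_kvec[of 1] by (simp_all add: kvec_0)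
  then show ?thesis
    by (auto simp: preinj_Gr_def sub)
qed

text \<open>Both counts are proved together because their recursions are coupled. The cutoff
  \<open>a \<le> int n\<close> is essential: for a = b = n + 1 the product would be q^(n+1), while
  no submodule exists.\<close>

lemma card_preinj_Gr_inj_and_preinj_Gr:
  fixes a b :: int
  defines "q \<equiv> real CARD('k::{field,finite})"
  shows "real (card (preinj_Gr_inj n a b :: ((nat \<Rightarrow> 'k) set \<times> _) set)) =
      (if a \<le> int n then gauss (a - b) (int n - b) q * q powi b * gauss b a q else 0) \<and>
    real (card (preinj_Gr n a b :: ((nat \<Rightarrow> 'k) set \<times> _) set)) =
      (if a > int n \<or> b > int n + 1 then 0
       else if a = int n \<and> b = int n + 1 then 1
       else gauss (a - b) (int n - b) q * gauss b (a + 1) q)"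
proof -
  have q: "q > 1"
    using card_mono[of UNIV "{0, 1 :: 'k}"] by (simp add: q_def)
  show ?thesis
  proof (induction n arbitrary: a b)
    case 0
    have "unit_fun 0 \<noteq> (0 :: nat \<Rightarrow> 'k)"
      by (auto simp: unit_fun_def fun_eq_iff)
    then have "preinj_Gr_inj 0 a b = (if a = 0 \<and> b = 0 then {({0}, {0})} else {} :: ((nat \<Rightarrow> 'k) set \<times> _) set)"
      by (auto simp: preinj_Gr_inj_def preinj_Gr_0)
    \<comment> \<open>For negative \<open>a\<close> one of the two upper indices is negative, which
      makes the product vanish.\<close>
    moreover have "a < 0 \<Longrightarrow> a - b < 0 \<or> b < 0" by linarith
    ultimately show ?case
      by (cases "a < 0"; cases "b < 0"; cases "a = 0"; cases "b = 0") (auto simp: preinj_Gr_0)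
  next
    case (Suc n)
    let ?A = "\<lambda>a b. real (card (preinj_Gr n a b :: ((nat \<Rightarrow> 'k) set \<times> _) set))"
    let ?B = "\<lambda>m a b. real (card (preinj_Gr_inj m a b :: ((nat \<Rightarrow> 'k) set \<times> _) set))"
    have A: "?A a b = (if a > int n \<or> b > int n + 1 then 0
       else if a = int n \<and> b = int n + 1 then 1
       else gauss (a - b) (int n - b) q * gauss b (a + 1) q)" for a b
      using Suc.IH by blast
    have "?B (Suc n) a b = q powi b * ?A (a - 1) b + q powi (a - b) * ?B n a b"
      unfolding q_def by (rule card_preinj_Gr_inj_Suc)
    also have "?B n a b = (if a \<le> int n then gauss (a - b) (int n - b) q * q powi b * gauss b a q else 0)"
      using Suc.IH by blast
    also have "q powi b * ?A (a - 1) b + q powi (a - b) * \<dots> =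
      (if a \<le> int (Suc n) then gauss (a - b) (int (Suc n) - b) q * q powi b * gauss b a q else 0)"
    proof -
      consider "a \<le> int n" | "a = int n + 1" | "a > int n + 1" by linarith
      then show ?thesis
      proof cases
        case 1
        \<comment> \<open>Since a - 1 < n, the exceptional value cannot occur; for b > n + 1 the
          negative upper index gives the required 0.\<close>
        then have "?A (a - 1) b = gauss (a - b - 1) (int n - b) q * gauss b a q"
          unfolding A by (auto simp: algebra_simps)
        moreover have "gauss (a - b) (int (Suc n) - b) q =
            gauss (a - b - 1) (int n - b) q + q powi (a - b) * gauss (a - b) (int n - b) q"
          using gauss_pascal[OF q, of "a - b" "int n - b"] by (simp add: algebra_simps)
        ultimately show ?thesis using 1 by (simp add: algebra_simps)
      next
        \<comment> \<open>At this boundary the \<open>preinj_Gr_inj n\<close> term is 0, and all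
          Gaussian coefficients that remain for b at most n + 1 have equal indices or a common
          factor on both sides.\<close>
        case 2
        consider "b \<le> int n" | "b = int n + 1" | "b > int n + 1" by linarith
        then show ?thesis
        proof cases
          case 1
          with 2 show ?thesis
            using gauss_self[OF q, of "int n - b"] gauss_self[OF q, of "int n + 1 - b"]
            by (simp add: A algebra_simps)
        next
          \<comment> \<open>Here \<open>?A (a - 1) b\<close> is the exceptional value 1, which
            counts the whole module \<open>I_n\<close>.\<close>
          case 2
          with \<open>a = int n + 1\<close> show ?thesis
            using gauss_self[OF q, of "int n + 1"] by (simp add: A algebra_simps)
        next
          case 3
          with 2 show ?thesis by (simp add: A)
        qed
      next
        case 3
        then show ?thesis by (simp add: A)
      qed
    qed
    finally have B: "?B (Suc n) a b =
      (if a \<le> int (Suc n) then gauss (a - b) (int (Suc n) - b) q * q powi b * gauss b a q else 0)" .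
    have "real (card (preinj_Gr (Suc n) a b :: ((nat \<Rightarrow> 'k) set \<times> _) set)) = ?A (a - 1) (b - 1) + ?B (Suc n) a b"
      by (simp add: card_preinj_Gr_Suc)
    also have "\<dots> = (if a > int (Suc n) \<or> b > int (Suc n) + 1 then 0
       else if a = int (Suc n) \<and> b = int (Suc n) + 1 then 1
       else gauss (a - b) (int (Suc n) - b) q * gauss b (a + 1) q)"
    proof -
      \<comment> \<open>The two Pascal terms match the two summands of the recursion. The
        exceptional value at (n+1, n+2) is inherited from (n, n+1), where the other summand is 0 by
        its negative upper index.\<close>
      have "gauss b (a + 1) q = gauss (b - 1) a q + q powi b * gauss b a q"
        by (rule gauss_pascal[OF q])
      then show ?thesis
        unfolding A B by (auto simp: algebra_simps)
    qed
    finally show ?case using B by blast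
  qed
qed

theorem theorem4p3:
  fixes n :: nat and a b :: int and q :: nat
  assumes "q = CARD('k::{field,finite})"
  shows "real (card (preinj.Gr n a b :: ((nat \<Rightarrow> 'k) set \<times> (nat \<Rightarrow> 'k) set) set)) =
    (if a > int n \<or> b > int n + 1 then 0
     else if a = int n \<and> b = int n + 1 then 1
     else gauss (a - b) (int n - b) (real q) * gauss b (a + 1) (real q))"
  using card_preinj_Gr_inj_and_preinj_Gr[where 'k = 'k, of n a b] unfolding Gr_eq_preinj_Gr assms by blast

end
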